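(* Let $M$ be a connected closed manifold, $L:TM\to\mathbb{R}$ a time-independent Tonelli Lagrangian whose Mañé critical value is $c[0]=0$, $u^-:M\to\mathbb{R}$ a weak KAM solution, and let the cost function be $c=h$, where $h$ is the Peierls' barrier. Then for any $y\in M$ there exists a static class $\mathcal{A}_y$ such that $\mathcal{A}_y\subset\partial^cu^-(y)$.
   Context: Tonelli Lagrangian (time-independent): $L:TM\to\mathbb{R}$ is $C^2$, $v\mapsto L(x,v)$ is strictly convex for every $x$, and there are a superlinear function $\theta:[0,\infty)\to[0,\infty)$ and a constant $c_0\ge 0$ with $L(x,v)\ge\theta(|v|_x)-c_0$. For $t>0$ let $h(0,t,x,y):=\inf_{\gamma}\int_{0}^{t}L(\gamma(s),\dot\gamma(s))\,ds$, the infimum over absolutely continuous $\gamma:[0,t]\to M$ with $\gamma(0)=x$, $\gamma(t)=y$. The Peierls' barrier is $h(x,y)=\liminf_{t\to\infty}\big(h(0,t,x,y)+c[0]t\big)$, where $c[0]$ is the Mañé critical value of $L$ (the unique constant for which this liminf is finite); here $c[0]=0$. A weak KAM solution is a (continuous) function $u^-:M\to\mathbb{R}$ with $u^-(x)=\inf_{y\in M}\{u^-(y)+h(0,t,y,x)\}$ for all $t>0$, $x\in M$ (recall $c[0]=0$). The projected Aubry set is $\mathcal{A}=\{x\in M: h(x,x)=0\}$. On $\mathcal{A}$, $d(x,y)=h(x,y)+h(y,x)$ is a pseudo-distance; the equivalence classes of the relation $d(x,y)=0$ on $\mathcal A$ are called static classes. For the cost $c=h$: $\partial^cu^-(y):=\{x\in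 M:\ u^-(\cdot)-h(x,\cdot)\ \text{attains its maximum at}\ y\}$. *)

theory Defs
  imports "HOL-Analysis.Analysis"
begin

section \<open>Smooth manifolds and tangent vectors\<close>

text \<open>Meant for open sets \<^term>\<open>S\<close> and finite-dimensional domains, where all directional derivatives
  of order at most \<open>k\<close> being continuous is the usual notion of class \<open>C\<^sup>k\<close>.\<close>

primrec Ck_on :: "nat \<Rightarrow> ('a::real_normed_vector \<Rightarrow> 'b::real_normed_vector) \<Rightarrow> 'a set \<Rightarrow> bool" where
  "Ck_on 0 f S \<longleftrightarrow> continuous_on S f"
| "Ck_on (Suc k) f S \<longleftrightarrow>
     (\<forall>x\<in>S. f differentiable (at x)) \<and> (\<forall>v. Ck_on k (\<lambda>x. frechet_derivative f (at x) v) S)"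

definition smooth_on :: "('a::real_normed_vector \<Rightarrow> 'b::real_normed_vector) \<Rightarrow> 'a set \<Rightarrow> bool" where
  "smooth_on f S \<longleftrightarrow> (\<forall>k. Ck_on k f S)"

text \<open>A chart is a pair of its domain and its coordinate map; the values of the coordinate map
  outside the domain are irrelevant.\<close>

type_synonym ('m, 'e) chart = "'m set \<times> ('m \<Rightarrow> 'e)"

abbreviation chart_inv :: "('m, 'e) chart \<Rightarrow> 'e \<Rightarrow> 'm" where
  "chart_inv c \<equiv> inv_into (fst c) (snd c)"

text \<open>The manifold is the whole type \<open>'m\<close>; its Hausdorff and second countability properties are
  supplied by the type classes.\<close>

definition smooth_atlas ::
  "('m::{t2_space,second_countable_topology}, 'e::euclidean_space) chart set \<Rightarrow> bool" where
  "smooth_atlas A \<longleftrightarrow>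
     (\<Union>c\<in>A. fst c) = UNIV \<and>
     (\<forall>c\<in>A. open (fst c) \<and> open (snd c ` fst c) \<and>
        homeomorphism (fst c) (snd c ` fst c) (snd c) (chart_inv c)) \<and>
     (\<forall>c\<in>A. \<forall>d\<in>A. smooth_on (snd d \<circ> chart_inv c) (snd c ` (fst c \<inter> fst d)))"

definition closed_manifold ::
  "('m::{t2_space,second_countable_topology}, 'e::euclidean_space) chart set \<Rightarrow> bool" where
  "closed_manifold A \<longleftrightarrow> smooth_atlas A \<and> compact (UNIV :: 'm set)"

text \<open>A tangent vector at \<open>x\<close> is the family of its coordinate representations in all charts around
  \<open>x\<close>, these being related by the differentials of the coordinate changes. To make the family
  unique, it is zero at every other index. The vector space operations are the pointwise ones.\<close>

type_synonym ('m, 'e) tvec = "('m, 'e) chart \<Rightarrow> 'e"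

definition tangent_space ::
  "('m, 'e::euclidean_space) chart set \<Rightarrow> 'm \<Rightarrow> ('m, 'e) tvec set" where
  "tangent_space A x =
     {v. (\<forall>c. c \<notin> A \<or> x \<notin> fst c \<longrightarrow> v c = 0) \<and>
         (\<forall>c\<in>A. \<forall>d\<in>A. x \<in> fst c \<and> x \<in> fst d \<longrightarrow>
            v d = frechet_derivative (snd d \<circ> chart_inv c) (at (snd c x)) (v c))}"

definition tvec_zero :: "('m, 'e::euclidean_space) tvec" where
  "tvec_zero = (\<lambda>c. 0)"

definition tvec_lincomb ::
  "real \<Rightarrow> ('m, 'e::euclidean_space) tvec \<Rightarrow> real \<Rightarrow> ('m, 'e) tvec \<Rightarrow> ('m, 'e) tvec" where
  "tvec_lincomb a v b w = (\<lambda>c. a *\<^sub>R v c + b *\<^sub>R w c)"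

text \<open>The tangent vector at \<open>x\<close> whose representation in the chart \<open>c\<close> around \<open>x\<close> is \<open>e\<close>.\<close>

definition tvec_of ::
  "('m, 'e::euclidean_space) chart set \<Rightarrow> ('m, 'e) chart \<Rightarrow> 'm \<Rightarrow> 'e \<Rightarrow> ('m, 'e) tvec" where
  "tvec_of A c x e = (\<lambda>d. if d \<in> A \<and> x \<in> fst d
     then frechet_derivative (snd d \<circ> chart_inv c) (at (snd c x)) e else 0)"

definition riemannian_metric ::
  "('m, 'e::euclidean_space) chart set \<Rightarrow>
     ('m \<Rightarrow> ('m, 'e) tvec \<Rightarrow> ('m, 'e) tvec \<Rightarrow> real) \<Rightarrow> bool" where
  "riemannian_metric A g \<longleftrightarrow>
     (\<forall>x. \<forall>v\<in>tangent_space A x. \<forall>w\<in>tangent_space A x. g x v w = g x w v) \<and>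
     (\<forall>x. \<forall>v\<in>tangent_space A x. \<forall>w\<in>tangent_space A x. \<forall>z\<in>tangent_space A x. \<forall>a b.
        g x (tvec_lincomb a v b w) z = a * g x v z + b * g x w z) \<and>
     (\<forall>x. \<forall>v\<in>tangent_space A x. v \<noteq> tvec_zero \<longrightarrow> g x v v > 0) \<and>
     (\<forall>c\<in>A. \<forall>e e'. smooth_on
        (\<lambda>p. g (chart_inv c p) (tvec_of A c (chart_inv c p) e) (tvec_of A c (chart_inv c p) e'))
        (snd c ` fst c))"

definition tvec_norm ::
  "('m \<Rightarrow> ('m, 'e) tvec \<Rightarrow> ('m, 'e) tvec \<Rightarrow> real) \<Rightarrow> 'm \<Rightarrow> ('m, 'e) tvec \<Rightarrow> real" where
  "tvec_norm g x v = sqrt (g x v v)"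


section \<open>Tonelli Lagrangians and their action\<close>

text \<open>A function on the tangent bundle is written in curried form; only its values \<open>L x v\<close> with
  \<open>v\<close> in the tangent space at \<open>x\<close> matter.\<close>

definition tonelli_lagrangian ::
  "('m, 'e::euclidean_space) chart set \<Rightarrow>
     ('m \<Rightarrow> ('m, 'e) tvec \<Rightarrow> ('m, 'e) tvec \<Rightarrow> real) \<Rightarrow>
     ('m \<Rightarrow> ('m, 'e) tvec \<Rightarrow> real) \<Rightarrow> bool" where
  "tonelli_lagrangian A g L \<longleftrightarrow>
     (\<forall>c\<in>A. Ck_on 2 (\<lambda>(p, e). L (chart_inv c p) (tvec_of A c (chart_inv c p) e))
        ((snd c ` fst c) \<times> UNIV)) \<and>
     (\<forall>x. \<forall>v\<in>tangent_space A x. \<forall>w\<in>tangent_space A x. \<forall>s. v \<noteq> w \<and> 0 < s \<and> s < 1 \<longrightarrow>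
        L x (tvec_lincomb (1 - s) v s w) < (1 - s) * L x v + s * L x w) \<and>
     (\<exists>(\<theta> :: real \<Rightarrow> real) c0. c0 \<ge> 0 \<and> (\<forall>r\<ge>0. \<theta> r \<ge> 0) \<and>
        filterlim (\<lambda>r. \<theta> r / r) at_top at_top \<and>
        (\<forall>x. \<forall>v\<in>tangent_space A x. L x v \<ge> \<theta> (tvec_norm g x v) - c0))"

definition abs_continuous_on_interval ::
  "real \<Rightarrow> real \<Rightarrow> (real \<Rightarrow> 'e::real_normed_vector) \<Rightarrow> bool" where
  "abs_continuous_on_interval a b f \<longleftrightarrow>
     (\<forall>\<epsilon>>0. \<exists>\<delta>>0. \<forall>P. finite P \<and>
        (\<forall>(s, t)\<in>P. a \<le> s \<and> s \<le> t \<and> t \<le> b) \<and>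
        pairwise (\<lambda>(s, t) (s', t'). disjnt {s<..<t} {s'<..<t'}) P \<and>
        (\<Sum>(s, t)\<in>P. t - s) < \<delta> \<longrightarrow>
        (\<Sum>(s, t)\<in>P. norm (f t - f s)) < \<epsilon>)"

definition ac_curve ::
  "('m::topological_space, 'e::euclidean_space) chart set \<Rightarrow> real \<Rightarrow> (real \<Rightarrow> 'm) \<Rightarrow> bool" where
  "ac_curve A T \<gamma> \<longleftrightarrow> continuous_on {0..T} \<gamma> \<and>
     (\<forall>c\<in>A. \<forall>a b. 0 \<le> a \<and> a \<le> b \<and> b \<le> T \<and> \<gamma> ` {a..b} \<subseteq> fst c \<longrightarrow>
        abs_continuous_on_interval a b (snd c \<circ> \<gamma>))"

text \<open>By convention the velocity is zero at the times where the curve is not differentiable; for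
  an absolutely continuous curve these form a null set, invisible to the action.\<close>

definition velocity ::
  "('m, 'e::euclidean_space) chart set \<Rightarrow> (real \<Rightarrow> 'm) \<Rightarrow> real \<Rightarrow> ('m, 'e) tvec" where
  "velocity A \<gamma> s =
     (if \<forall>c\<in>A. \<gamma> s \<in> fst c \<longrightarrow> (snd c \<circ> \<gamma>) differentiable (at s)
      then (\<lambda>c. if c \<in> A \<and> \<gamma> s \<in> fst c then vector_derivative (snd c \<circ> \<gamma>) (at s) else 0)
      else tvec_zero)"

text \<open>A Tonelli Lagrangian is bounded below, so along an absolutely continuous curve a
  non-integrable integrand has integral \<open>\<infinity>\<close>.\<close>

definition action ::
  "('m, 'e::euclidean_space) chart set \<Rightarrow> ('m \<Rightarrow> ('m, 'e) tvec \<Rightarrow> real) \<Rightarrow>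
     real \<Rightarrow> (real \<Rightarrow> 'm) \<Rightarrow> ereal" where
  "action A L t \<gamma> =
     (if (\<lambda>s. L (\<gamma> s) (velocity A \<gamma> s)) absolutely_integrable_on {0..t}
      then ereal (integral {0..t} (\<lambda>s. L (\<gamma> s) (velocity A \<gamma> s))) else \<infinity>)"

definition min_action ::
  "('m::topological_space, 'e::euclidean_space) chart set \<Rightarrow>
     ('m \<Rightarrow> ('m, 'e) tvec \<Rightarrow> real) \<Rightarrow> real \<Rightarrow> 'm \<Rightarrow> 'm \<Rightarrow> ereal" where
  "min_action A L t x y =
     (INF \<gamma>\<in>{\<gamma>. ac_curve A t \<gamma> \<and> \<gamma> 0 = x \<and> \<gamma> t = y}. action A L t \<gamma>)"


section \<open>Weak KAM theory\<close>

definition barrier_at ::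
  "('m::topological_space, 'e::euclidean_space) chart set \<Rightarrow>
     ('m \<Rightarrow> ('m, 'e) tvec \<Rightarrow> real) \<Rightarrow> real \<Rightarrow> 'm \<Rightarrow> 'm \<Rightarrow> ereal" where
  "barrier_at A L k x y = Liminf at_top (\<lambda>t. min_action A L t x y + ereal (k * t))"

definition mane_critical_value ::
  "('m::topological_space, 'e::euclidean_space) chart set \<Rightarrow>
     ('m \<Rightarrow> ('m, 'e) tvec \<Rightarrow> real) \<Rightarrow> real" where
  "mane_critical_value A L = (THE k. \<forall>x y. \<bar>barrier_at A L k x y\<bar> \<noteq> \<infinity>)"

definition peierls_barrier ::
  "('m::topological_space, 'e::euclidean_space) chart set \<Rightarrow>
     ('m \<Rightarrow> ('m, 'e) tvec \<Rightarrow> real) \<Rightarrow> 'm \<Rightarrow> 'm \<Rightarrow> ereal" where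
  "peierls_barrier A L = barrier_at A L (mane_critical_value A L)"

text \<open>Stated for Lagrangians whose critical value is zero; in general \<open>min_action A L t z x\<close>
  has to be augmented by the critical value times \<open>t\<close>.\<close>

definition weak_KAM_solution ::
  "('m::topological_space, 'e::euclidean_space) chart set \<Rightarrow>
     ('m \<Rightarrow> ('m, 'e) tvec \<Rightarrow> real) \<Rightarrow> ('m \<Rightarrow> real) \<Rightarrow> bool" where
  "weak_KAM_solution A L u \<longleftrightarrow> continuous_on UNIV u \<and>
     (\<forall>t>0. \<forall>x. ereal (u x) = (INF z. ereal (u z) + min_action A L t z x))"

definition aubry_set ::
  "('m::topological_space, 'e::euclidean_space) chart set \<Rightarrow>
     ('m \<Rightarrow> ('m, 'e) tvec \<Rightarrow> real) \<Rightarrow> 'm set" where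
  "aubry_set A L = {x. peierls_barrier A L x x = 0}"

definition static_classes ::
  "('m::topological_space, 'e::euclidean_space) chart set \<Rightarrow>
     ('m \<Rightarrow> ('m, 'e) tvec \<Rightarrow> real) \<Rightarrow> 'm set set" where
  "static_classes A L = aubry_set A L //
     {(x, y). x \<in> aubry_set A L \<and> y \<in> aubry_set A L \<and>
        peierls_barrier A L x y + peierls_barrier A L y x = 0}"

definition c_superdifferential ::
  "('m \<Rightarrow> 'm \<Rightarrow> ereal) \<Rightarrow> ('m \<Rightarrow> real) \<Rightarrow> 'm \<Rightarrow> 'm set" where
  "c_superdifferential c u y =
     {x. \<forall>z. ereal (u z) - c x z \<le> ereal (u y) - c x y}"

end

theory Submission
  imports Defs
begin

text \<open>Write \<open>h\<^sub>t\<close> for the minimal action in time \<open>t\<close>. A weak KAM solution is dominated,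
  \<open>u y - u x \<le> h x y\<close>, so a point \<open>x\<close> with \<open>h x y = u y - u x\<close> lies in the
  superdifferential at \<open>y\<close>, and by the triangle inequality this equality propagates along the static
  class of \<open>x\<close>. It remains to find such an \<open>x\<close> in the Aubry set. Instead of taking the
  \<open>\<alpha>\<close>-limit of a calibrated curve, whose existence needs Tonelli's theorem, choose points
  \<open>q 0 = y, q 1, q 2, \<dots>\<close> such that each step from \<open>q (k + 1)\<close> to \<open>q k\<close> in time 1 realises the
  weak KAM infimum up to a summable error. A limit point of this sequence works up to the total
  error, because nearby points are joined in short time with small action; then let the error tend
  to zero.\<close>

section \<open>Absolutely continuous functions on an interval\<close>

text \<open>A nondecreasing map \<open>\<phi>\<close> that does not expand lengths sends disjoint
  intervals to intervals that are disjoint or degenerate, of no larger total length, so the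
  \<open>\<delta>\<close> of \<open>f\<close> also works for \<open>h\<close>. Below,
  \<open>\<phi>\<close> is an identity, a translation or a truncation.\<close>

lemma abs_continuous_on_interval_reparam:
  fixes \<phi> :: "real \<Rightarrow> real"
  assumes f: "abs_continuous_on_interval a' b' f"
    and \<phi>: "\<And>s t. a \<le> s \<Longrightarrow> s \<le> t \<Longrightarrow> t \<le> b \<Longrightarrow> \<phi> s \<le> \<phi> t \<and> \<phi> t - \<phi> s \<le> t - s"
    and h: "\<And>s. a \<le> s \<Longrightarrow> s \<le> b \<Longrightarrow> a' \<le> \<phi> s \<and> \<phi> s \<le> b' \<and> h s = f (\<phi> s)"
  shows "abs_continuous_on_interval a b h"
  unfolding abs_continuous_on_interval_def
proof (intro allI impI)
  fix \<epsilon> :: real assume "\<epsilon> > 0"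
  then obtain \<delta> where "\<delta> > 0" and \<delta>: "\<And>P. \<lbrakk>finite P; \<forall>(s, t)\<in>P. a' \<le> s \<and> s \<le> t \<and> t \<le> b';
      pairwise (\<lambda>(s, t) (s', t'). disjnt {s<..<t} {s'<..<t'}) P; (\<Sum>(s, t)\<in>P. t - s) < \<delta>\<rbrakk>
      \<Longrightarrow> (\<Sum>(s, t)\<in>P. norm (f t - f s)) < \<epsilon>"
    using f[unfolded abs_continuous_on_interval_def, THEN spec, THEN mp, of \<epsilon>] by blast
  show "\<exists>\<delta>>0. \<forall>P. finite P \<and> (\<forall>(s, t)\<in>P. a \<le> s \<and> s \<le> t \<and> t \<le> b) \<and>
        pairwise (\<lambda>(s, t) (s', t'). disjnt {s<..<t} {s'<..<t'}) P \<and>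
        (\<Sum>(s, t)\<in>P. t - s) < \<delta> \<longrightarrow> (\<Sum>(s, t)\<in>P. norm (h t - h s)) < \<epsilon>"
  proof (intro exI conjI allI impI)
    fix P :: "(real \<times> real) set"
    let ?m = "map_prod \<phi> \<phi>"
    assume P: "finite P \<and> (\<forall>(s, t)\<in>P. a \<le> s \<and> s \<le> t \<and> t \<le> b) \<and>
        pairwise (\<lambda>(s, t) (s', t'). disjnt {s<..<t} {s'<..<t'}) P \<and>
        (\<Sum>(s, t)\<in>P. t - s) < \<delta>"
    then have fin: "finite P" and bd: "\<And>s t. (s, t) \<in> P \<Longrightarrow> a \<le> s \<and> s \<le> t \<and> t \<le> b"
      and pw: "pairwise (\<lambda>(s, t) (s', t'). disjnt {s<..<t} {s'<..<t'}) P"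
      and len: "(\<Sum>(s, t)\<in>P. t - s) < \<delta>"
      by blast+
    \<comment> \<open>Two intervals with disjoint interiors are ordered, or one of them is trivial;
      \<open>\<phi>\<close> preserves both alternatives.\<close>
    have sep: "\<phi> t \<le> \<phi> s' \<or> \<phi> t' \<le> \<phi> s \<or> \<phi> s = \<phi> t \<or> \<phi> s' = \<phi> t'"
      if p: "(s, t) \<in> P" "(s', t') \<in> P" "(s, t) \<noteq> (s', t')" for s t s' t'
    proof -
      have "disjnt {s<..<t} {s'<..<t'}"
        using pw p unfolding pairwise_def by blast
      then have "max s s' \<ge> min t t'"
        unfolding disjnt_def
        by (metis Int_greaterThanLessThan greaterThanLessThan_empty_iff)
      then have "t \<le> s' \<or> t' \<le> s \<or> s = t \<or> s' = t'"
        using bd[OF p(1)] bd[OF p(2)] by linarith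
      then show ?thesis
        using bd[OF p(1)] bd[OF p(2)] \<phi>[of t s'] \<phi>[of t' s] by auto
    qed
    \<comment> \<open>\<open>P\<close> is a set, so \<open>?m\<close> may merge several of its
      members. Merged intervals become degenerate and contribute nothing to a sum whose summand
      vanishes on the diagonal; hence the premise of \<open>sum_image\<close>.\<close>
    have nontriv: "fst (?m p) = snd (?m p)"
      if p: "p \<in> P" "q \<in> P" "p \<noteq> q" "?m p = ?m q" for p q
    proof -
      obtain s t s' t' where [simp]: "p = (s, t)" "q = (s', t')" by force
      show ?thesis
        using sep[of s t s' t'] \<phi>[of s t] \<phi>[of s' t'] bd[of s t] bd[of s' t'] p by auto
    qed
    have sum_image: "(\<Sum>(s, t)\<in>?m ` P. F s t) = (\<Sum>(s, t)\<in>P. F (\<phi> s) (\<phi> t))"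
      if "\<And>s. F s s = 0" for F :: "real \<Rightarrow> real \<Rightarrow> real"
    proof -
      have "(\<Sum>(s, t)\<in>?m ` P. F s t) = sum ((\<lambda>(s, t). F s t) \<circ> ?m) P"
        by (rule sum.reindex_nontrivial[OF fin]) (metis nontriv prod.collapse case_prod_conv that)
      then show ?thesis
        by (simp add: case_prod_unfold o_def)
    qed
    have "(\<Sum>(s, t)\<in>?m ` P. norm (f t - f s)) < \<epsilon>"
    proof (rule \<delta>)
      show "finite (?m ` P)" using fin by simp
      show "\<forall>(s, t)\<in>?m ` P. a' \<le> s \<and> s \<le> t \<and> t \<le> b'"
      proof clarsimp
        fix s t assume "(s, t) \<in> P"
        then show "a' \<le> \<phi> s \<and> \<phi> s \<le> \<phi> t \<and> \<phi> t \<le> b'"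
          using bd[of s t] h[of s] h[of t] \<phi>[of s t] by simp
      qed
      show "pairwise (\<lambda>(s, t) (s', t'). disjnt {s<..<t} {s'<..<t'}) (?m ` P)"
      proof (rule pairwise_imageI)
        fix p q assume "p \<in> P" "q \<in> P" "p \<noteq> q"
        moreover obtain s t s' t' where "p = (s, t)" "q = (s', t')" by force
        ultimately show "(case ?m p of (s, t) \<Rightarrow> \<lambda>(s', t'). disjnt {s<..<t} {s'<..<t'}) (?m q)"
          using sep[of s t s' t'] by (auto simp: disjnt_def)
      qed
      have "(\<Sum>(s, t)\<in>?m ` P. t - s) = (\<Sum>(s, t)\<in>P. \<phi> t - \<phi> s)"
        by (rule sum_image) simp
      also have "\<dots> \<le> (\<Sum>(s, t)\<in>P. t - s)"
        using bd \<phi> by (intro sum_mono) auto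
      finally show "(\<Sum>(s, t)\<in>?m ` P. t - s) < \<delta>" using len by simp
    qed
    also have "(\<Sum>(s, t)\<in>?m ` P. norm (f t - f s)) = (\<Sum>(s, t)\<in>P. norm (f (\<phi> t) - f (\<phi> s)))"
      by (rule sum_image) simp
    also have "\<dots> = (\<Sum>(s, t)\<in>P. norm (h t - h s))"
    proof (rule sum.cong[OF refl], clarify)
      fix s t assume "(s, t) \<in> P"
      then show "norm (f (\<phi> t) - f (\<phi> s)) = norm (h t - h s)"
        using bd[of s t] h[of s] h[of t] by simp
    qed
    finally show "(\<Sum>(s, t)\<in>P. norm (h t - h s)) < \<epsilon>" .
  qed fact
qed

lemma abs_continuous_on_interval_add:
  assumes "abs_continuous_on_interval a b f" "abs_continuous_on_interval a b g"
  shows "abs_continuous_on_interval a b (\<lambda>x. f x + g x)"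
  unfolding abs_continuous_on_interval_def
proof (intro allI impI)
  fix \<epsilon> :: real assume "\<epsilon> > 0"
  then have e: "\<epsilon> / 2 > 0" by simp
  obtain \<delta>1 where "\<delta>1 > 0" and \<delta>1: "\<And>P. finite P \<and> (\<forall>(s, t)\<in>P. a \<le> s \<and> s \<le> t \<and> t \<le> b) \<and>
        pairwise (\<lambda>(s, t) (s', t'). disjnt {s<..<t} {s'<..<t'}) P \<and>
        (\<Sum>(s, t)\<in>P. t - s) < \<delta>1 \<Longrightarrow> (\<Sum>(s, t)\<in>P. norm (f t - f s)) < \<epsilon> / 2"
    using assms(1)[unfolded abs_continuous_on_interval_def, THEN spec, THEN mp, OF e] by blast
  obtain \<delta>2 where "\<delta>2 > 0" and \<delta>2: "\<And>P. finite P \<and> (\<forall>(s, t)\<in>P. a \<le> s \<and> s \<le> t \<and> t \<le> b) \<and>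
        pairwise (\<lambda>(s, t) (s', t'). disjnt {s<..<t} {s'<..<t'}) P \<and>
        (\<Sum>(s, t)\<in>P. t - s) < \<delta>2 \<Longrightarrow> (\<Sum>(s, t)\<in>P. norm (g t - g s)) < \<epsilon> / 2"
    using assms(2)[unfolded abs_continuous_on_interval_def, THEN spec, THEN mp, OF e] by blast
  show "\<exists>\<delta>>0. \<forall>P. finite P \<and> (\<forall>(s, t)\<in>P. a \<le> s \<and> s \<le> t \<and> t \<le> b) \<and>
        pairwise (\<lambda>(s, t) (s', t'). disjnt {s<..<t} {s'<..<t'}) P \<and>
        (\<Sum>(s, t)\<in>P. t - s) < \<delta> \<longrightarrow> (\<Sum>(s, t)\<in>P. norm (f t + g t - (f s + g s))) < \<epsilon>"
  proof (intro exI conjI allI impI)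
    show "min \<delta>1 \<delta>2 > 0" using \<open>\<delta>1 > 0\<close> \<open>\<delta>2 > 0\<close> by simp
    fix P :: "(real \<times> real) set"
    assume P: "finite P \<and> (\<forall>(s, t)\<in>P. a \<le> s \<and> s \<le> t \<and> t \<le> b) \<and>
        pairwise (\<lambda>(s, t) (s', t'). disjnt {s<..<t} {s'<..<t'}) P \<and>
        (\<Sum>(s, t)\<in>P. t - s) < min \<delta>1 \<delta>2"
    have "(\<Sum>(s, t)\<in>P. norm (f t + g t - (f s + g s)))
        \<le> (\<Sum>(s, t)\<in>P. norm (f t - f s) + norm (g t - g s))"
      by (intro sum_mono) (auto simp: add_diff_add norm_triangle_ineq)
    also have "\<dots> = (\<Sum>(s, t)\<in>P. norm (f t - f s)) + (\<Sum>(s, t)\<in>P. norm (g t - g s))"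
      by (simp add: case_prod_unfold sum.distrib)
    also have "\<dots> < \<epsilon>" using \<delta>1[of P] \<delta>2[of P] P by simp
    finally show "(\<Sum>(s, t)\<in>P. norm (f t + g t - (f s + g s))) < \<epsilon>" .
  qed
qed

text \<open>Up to the constant \<open>f m\<close>, the function \<open>f\<close> is the sum of its
  truncations \<open>f (min x m)\<close> and \<open>f (max x m)\<close>. Each of them reparametrizes
  one half, and only increments matter, so no interval has to be cut at \<open>m\<close>.\<close>

lemma abs_continuous_on_interval_combine:
  assumes f: "abs_continuous_on_interval a m f" "abs_continuous_on_interval m b f"
    and "a \<le> m" "m \<le> b"
  shows "abs_continuous_on_interval a b f"
proof -
  have "abs_continuous_on_interval a b (\<lambda>x. f (min x m))"
    by (rule abs_continuous_on_interval_reparam[OF f(1), where \<phi> = "\<lambda>x. min x m"])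
      (use assms in auto)
  moreover have "abs_continuous_on_interval a b (\<lambda>x. f (max x m))"
    by (rule abs_continuous_on_interval_reparam[OF f(2), where \<phi> = "\<lambda>x. max x m"])
      (use assms in auto)
  ultimately have "abs_continuous_on_interval a b (\<lambda>x. f (min x m) + f (max x m))"
    by (rule abs_continuous_on_interval_add)
  moreover have "f (min t m) + f (max t m) - (f (min s m) + f (max s m)) = f t - f s" for s t
    by (cases "s \<le> m"; cases "t \<le> m") auto
  ultimately show ?thesis unfolding abs_continuous_on_interval_def by simp
qed

lemma lipschitz_on_imp_abs_continuous_on_interval:
  assumes "K-lipschitz_on {a..b} f"
  shows "abs_continuous_on_interval a b f"
  unfolding abs_continuous_on_interval_def
proof (intro allI impI)
  fix \<epsilon> :: real assume "\<epsilon> > 0"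
  have K: "K \<ge> 0" using assms lipschitz_on_nonneg by blast
  show "\<exists>\<delta>>0. \<forall>P. finite P \<and> (\<forall>(s, t)\<in>P. a \<le> s \<and> s \<le> t \<and> t \<le> b) \<and>
        pairwise (\<lambda>(s, t) (s', t'). disjnt {s<..<t} {s'<..<t'}) P \<and>
        (\<Sum>(s, t)\<in>P. t - s) < \<delta> \<longrightarrow> (\<Sum>(s, t)\<in>P. norm (f t - f s)) < \<epsilon>"
  proof (intro exI conjI allI impI)
    \<comment> \<open>The summand 1 covers \<open>K = 0\<close> and makes the final inequality
      strict.\<close>
    show "\<epsilon> / (K + 1) > 0" using \<open>\<epsilon> > 0\<close> K by simp
    fix P :: "(real \<times> real) set"
    assume P: "finite P \<and> (\<forall>(s, t)\<in>P. a \<le> s \<and> s \<le> t \<and> t \<le> b) \<and>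
        pairwise (\<lambda>(s, t) (s', t'). disjnt {s<..<t} {s'<..<t'}) P \<and>
        (\<Sum>(s, t)\<in>P. t - s) < \<epsilon> / (K + 1)"
    have "(\<Sum>(s, t)\<in>P. norm (f t - f s)) \<le> (\<Sum>(s, t)\<in>P. K * (t - s))"
    proof (intro sum_mono, clarify)
      fix s t assume "(s, t) \<in> P"
      then show "norm (f t - f s) \<le> K * (t - s)"
        using P lipschitz_onD[OF assms, of t s] by (fastforce simp: dist_norm)
    qed
    also have "\<dots> = K * (\<Sum>(s, t)\<in>P. t - s)"
      by (simp add: case_prod_unfold sum_distrib_left)
    also have "\<dots> \<le> K * (\<epsilon> / (K + 1))"
      using P K by (intro mult_left_mono) auto
    also have "\<dots> < \<epsilon>" using K \<open>\<epsilon> > 0\<close> by (simp add: field_simps)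
    finally show "(\<Sum>(s, t)\<in>P. norm (f t - f s)) < \<epsilon>" .
  qed
qed

section \<open>Concatenation of curves\<close>

text \<open>The velocity depends only on the curve near the given time and commutes with time
  shifts. With \<open>s = 0\<close> this is pure locality, so both pieces of a concatenation are
  covered.\<close>

lemma velocity_shift:
  assumes S: "open S" "r \<in> S" and eq: "\<And>q. q \<in> S \<Longrightarrow> \<gamma> q = \<eta> (q - s)"
  shows "velocity A \<gamma> r = velocity A \<eta> (r - s)"
proof -
  have iff: "((F \<circ> \<gamma>) has_vector_derivative D) (at r)
      \<longleftrightarrow> ((F \<circ> \<eta>) has_vector_derivative D) (at (r - s))"
    for F :: "'a \<Rightarrow> 'b::euclidean_space" and D
  proof
    assume *: "((F \<circ> \<gamma>) has_vector_derivative D) (at r)"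
    have "((\<lambda>q. q + s) has_vector_derivative 1) (at (r - s))"
      by (auto intro!: derivative_eq_intros)
    then have "((F \<circ> \<gamma>) \<circ> (\<lambda>q. q + s) has_vector_derivative 1 *\<^sub>R D) (at (r - s))"
      by (rule vector_diff_chain_at) (use * in simp)
    moreover have "open ((\<lambda>q. q + s) -` S)"
      using S by (intro open_vimage) (auto intro!: continuous_intros)
    ultimately show "((F \<circ> \<eta>) has_vector_derivative D) (at (r - s))"
      using S eq by (auto elim!: has_vector_derivative_transform_within_open)
  next
    assume *: "((F \<circ> \<eta>) has_vector_derivative D) (at (r - s))"
    have "((\<lambda>q. q - s) has_vector_derivative 1) (at r)"
      by (auto intro!: derivative_eq_intros)
    then have "((F \<circ> \<eta>) \<circ> (\<lambda>q. q - s) has_vector_derivative 1 *\<^sub>R D) (at r)"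
      by (rule vector_diff_chain_at) (use * in simp)
    then show "((F \<circ> \<gamma>) has_vector_derivative D) (at r)"
      using S eq by (auto elim!: has_vector_derivative_transform_within_open)
  qed
  \<comment> \<open>Since \<open>iff\<close> holds for every \<open>D\<close>, it transfers the
    differentiability test in \<open>velocity\<close> as well as the value,
    \<open>vector_derivative\<close> being a choice among all such \<open>D\<close>.\<close>
  have "(F \<circ> \<gamma>) differentiable (at r) \<longleftrightarrow> (F \<circ> \<eta>) differentiable (at (r - s))"
    "vector_derivative (F \<circ> \<gamma>) (at r) = vector_derivative (F \<circ> \<eta>) (at (r - s))"
    for F :: "'a \<Rightarrow> 'b"
    using iff[of F] by (auto simp: vector_derivative_works vector_derivative_def)
  then show ?thesis
    unfolding velocity_def using eq[OF S(2)] by presburger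
qed

lemma ac_curve_concat:
  assumes "ac_curve A s \<gamma>" "ac_curve A t \<eta>" "\<gamma> s = \<eta> 0" "s \<ge> 0" "t \<ge> 0"
  shows "ac_curve A (s + t) (\<lambda>r. if r \<le> s then \<gamma> r else \<eta> (r - s))" (is "ac_curve A _ ?c")
  unfolding ac_curve_def
proof (intro conjI ballI allI impI)
  have "continuous_on ({0..s} \<union> {s..s + t}) ?c"
  proof (intro continuous_on_cases)
    show "continuous_on {0..s} \<gamma>" using assms by (simp add: ac_curve_def)
    show "continuous_on {s..s + t} (\<lambda>r. \<eta> (r - s))"
      by (rule continuous_on_compose2[of "{0..t}" \<eta> _ "\<lambda>r. r - s"])
        (use assms in \<open>auto simp: ac_curve_def intro!: continuous_intros\<close>)
  qed (use assms in auto)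
  then show "continuous_on {0..s + t} ?c"
    using assms by (simp add: ivl_disj_un_two_touch)
next
  fix c a b
  assume c: "c \<in> A" and ab: "0 \<le> a \<and> a \<le> b \<and> b \<le> s + t \<and> ?c ` {a..b} \<subseteq> fst c"
  then have "?c ` {a..b} \<subseteq> fst c" by (elim conjE)
  from subsetD[OF this imageI] have inc: "?c x \<in> fst c" if "a \<le> x" "x \<le> b" for x
    using that by simp
  have eq: "?c x = \<eta> (x - s)" if "s \<le> x" for x
    using that assms(3) by (cases "x = s") auto
  \<comment> \<open>With the identity as \<open>\<phi>\<close>, the reparametrization lemma acts as
    a congruence rule on the interval. The bound \<open>b'\<close> will be \<open>b\<close> or the
    junction \<open>s\<close>, depending on where \<open>s\<close> lies.\<close>
  have left: "abs_continuous_on_interval a b' (snd c \<circ> ?c)" if "a \<le> b'" "b' \<le> b" "b' \<le> s" for b'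
  proof (rule abs_continuous_on_interval_reparam[where \<phi> = "\<lambda>x. x"])
    have "\<gamma> x \<in> fst c" if "x \<in> {a..b'}" for x
      using inc[of x] that \<open>b' \<le> b\<close> \<open>b' \<le> s\<close> by simp
    then have "\<gamma> ` {a..b'} \<subseteq> fst c" by blast
    moreover have "0 \<le> a" using ab by blast
    ultimately show "abs_continuous_on_interval a b' (snd c \<circ> \<gamma>)"
      using assms(1) c that unfolding ac_curve_def by blast
  qed (use that in auto)
  have right: "abs_continuous_on_interval a' b (snd c \<circ> ?c)" if "a \<le> a'" "a' \<le> b" "s \<le> a'" for a'
  proof (rule abs_continuous_on_interval_reparam[where \<phi> = "\<lambda>x. x - s"])
    have "\<eta> x \<in> fst c" if "x \<in> {a' - s..b - s}" for x
    proof -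
      have "?c (x + s) \<in> fst c"
        using that \<open>a \<le> a'\<close> by (intro inc) auto
      moreover have "?c (x + s) = \<eta> x"
        using that \<open>s \<le> a'\<close> assms by (cases "x = 0") auto
      ultimately show ?thesis by simp
    qed
    then have "\<eta> ` {a' - s..b - s} \<subseteq> fst c" by blast
    moreover have "0 \<le> a' - s" "a' - s \<le> b - s" "b - s \<le> t" using ab that by auto
    ultimately show "abs_continuous_on_interval (a' - s) (b - s) (snd c \<circ> \<eta>)"
      using assms(2) c unfolding ac_curve_def by blast
  next
    fix x assume "a' \<le> x" "x \<le> b"
    then show "a' - s \<le> x - s \<and> x - s \<le> b - s \<and> (snd c \<circ> ?c) x = (snd c \<circ> \<eta>) (x - s)"
      using eq[of x] that by simp
  qed simp
  consider "b \<le> s" | "s \<le> a" | "a \<le> s" "s \<le> b" by linarith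
  then show "abs_continuous_on_interval a b (snd c \<circ> ?c)"
  proof cases
    case 1 show ?thesis by (rule left) (use 1 ab in simp_all)
  next
    case 2 show ?thesis by (rule right) (use 2 ab in simp_all)
  next
    case 3
    have "abs_continuous_on_interval a s (snd c \<circ> ?c)" by (rule left) (use 3 in simp_all)
    moreover have "abs_continuous_on_interval s b (snd c \<circ> ?c)" by (rule right) (use 3 in simp_all)
    ultimately show ?thesis using 3 by (rule abs_continuous_on_interval_combine)
  qed
qed

text \<open>An action other than \<open>\<infinity>\<close> means, by definition, that the
  Lagrangian is absolutely integrable along the curve. The junction time, where the velocity of the
  concatenation may agree with neither piece, is negligible.\<close>

lemma action_concat:
  fixes \<gamma> \<eta> :: "real \<Rightarrow> 'm" and A :: "('m, 'e::euclidean_space) chart set"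
  assumes "s \<ge> 0" "t \<ge> 0"
    and fin: "action A L s \<gamma> \<noteq> \<infinity>" "action A L t \<eta> \<noteq> \<infinity>"
  shows "action A L (s + t) (\<lambda>r. if r \<le> s then \<gamma> r else \<eta> (r - s))
      = action A L s \<gamma> + action A L t \<eta>" (is "action A L _ ?c = _")
proof -
  define f where "f = (\<lambda>r. L (\<gamma> r) (velocity A \<gamma> r))"
  define g where "g = (\<lambda>r. L (\<eta> r) (velocity A \<eta> r))"
  define h where "h = (\<lambda>r. L (?c r) (velocity A ?c r))"
  have f: "f absolutely_integrable_on {0..s}" and g: "g absolutely_integrable_on {0..t}"
    using fin unfolding action_def f_def g_def by (metis (full_types))+
  \<comment> \<open>Locality of the velocity needs an open set of times, so both comparisons omit
    \<open>s\<close>; this is the set \<open>{s}\<close> in the spike arguments below.\<close>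
  have hf: "h r = f r" if "r < s" for r
    using velocity_shift[of "{..<s}" r ?c \<gamma> 0 A] that by (simp add: h_def f_def)
  have hg: "h r = g (r - s)" if "r > s" for r
    using velocity_shift[of "{s<..}" r ?c \<eta> s A] that by (simp add: h_def g_def)
  have h1: "h absolutely_integrable_on {0..s}"
    by (rule absolutely_integrable_spike[OF f, of "{s}"]) (auto simp: hf)
  have "(\<lambda>r. g (r - s)) absolutely_integrable_on {s..s + t}"
    using g integrable_shift_real_ivl[of g 0 t "- s"]
      integrable_shift_real_ivl[of "\<lambda>r. norm (g r)" 0 t "- s"]
    by (simp add: absolutely_integrable_on_def add.commute)
  then have h2: "h absolutely_integrable_on {s..s + t}"
    by (rule absolutely_integrable_spike[of _ _ "{s}"]) (auto simp: hg)
  have h: "h absolutely_integrable_on {0..s + t}"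
    using absolutely_integrable_on_combine[OF h1 h2] assms by simp
  have "integral {0..s + t} h = integral {0..s} h + integral {s..s + t} h"
    using h assms by (subst Henstock_Kurzweil_Integration.integral_combine)
      (auto simp: absolutely_integrable_on_def)
  also have "integral {0..s} h = integral {0..s} f"
    by (rule integral_spike[of "{s}"]) (auto simp: hf)
  also have "integral {s..s + t} h = integral {s..s + t} (\<lambda>r. g (r - s))"
    by (rule integral_spike[of "{s}"]) (auto simp: hg)
  also have "\<dots> = integral {0..t} g"
    using integral_shift_real_ivl[of 0 "- s" t g] by (simp add: add.commute)
  finally show ?thesis
    using h f g unfolding action_def by (fold f_def g_def h_def) simp
qed

text \<open>Strict real bounds let curves be picked from the infimum without minimizers, and they
  keep infinite values out of the sum.\<close>

lemma min_action_triangle: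
  assumes "min_action A L s x y < ereal a" "min_action A L t y z < ereal b" "s \<ge> 0" "t \<ge> 0"
  shows "min_action A L (s + t) x z < ereal (a + b)"
proof -
  obtain \<gamma> where \<gamma>: "ac_curve A s \<gamma>" "\<gamma> 0 = x" "\<gamma> s = y" "action A L s \<gamma> < ereal a"
    using assms(1) unfolding min_action_def INF_less_iff by blast
  obtain \<eta> where \<eta>: "ac_curve A t \<eta>" "\<eta> 0 = y" "\<eta> t = z" "action A L t \<eta> < ereal b"
    using assms(2) unfolding min_action_def INF_less_iff by blast
  let ?c = "\<lambda>r. if r \<le> s then \<gamma> r else \<eta> (r - s)"
  have "action A L (s + t) ?c = action A L s \<gamma> + action A L t \<eta>"
    using \<gamma>(4) \<eta>(4) assms by (intro action_concat) auto
  also have "\<dots> < ereal a + ereal b"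
    using \<gamma>(4) \<eta>(4) by (rule ereal_add_strict_mono2)
  finally have "action A L (s + t) ?c < ereal (a + b)" by simp
  moreover have "?c (s + t) = z" using \<gamma> \<eta> assms by (cases "t = 0") auto
  ultimately show ?thesis
    using ac_curve_concat[OF \<gamma>(1) \<eta>(1)] \<gamma> \<eta> assms
    unfolding min_action_def INF_less_iff by (intro bexI[of _ ?c]) auto
qed

section \<open>Short segments in a chart\<close>

lemma Ck_on_Suc_imp_continuous_on:
  assumes "Ck_on (Suc k) f S"
  shows "continuous_on S f"
  using assms by (auto intro: continuous_at_imp_continuous_on differentiable_imp_continuous_within)

lemma tonelli_lagrangian_continuous_on_chart:
  assumes "tonelli_lagrangian A g L" "c \<in> A"
  shows "continuous_on ((snd c ` fst c) \<times> UNIV)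
    (\<lambda>(p, e). L (chart_inv c p) (tvec_of A c (chart_inv c p) e))"
proof (rule Ck_on_Suc_imp_continuous_on[of 1, unfolded Suc_1])
  show "Ck_on 2 (\<lambda>(p, e). L (chart_inv c p) (tvec_of A c (chart_inv c p) e))
      ((snd c ` fst c) \<times> UNIV)"
    by (rule bspec[OF conjunct1[OF assms(1)[unfolded tonelli_lagrangian_def]] assms(2)])
qed

lemma chart_transition:
  assumes "smooth_atlas A" "c \<in> A" "d \<in> A"
  defines "\<tau> \<equiv> snd d \<circ> chart_inv c" and "W \<equiv> snd c ` (fst c \<inter> fst d)"
  shows "\<And>z. z \<in> W \<Longrightarrow> (\<tau> has_derivative frechet_derivative \<tau> (at z)) (at z)"
    and "\<And>e. continuous_on W (\<lambda>z. frechet_derivative \<tau> (at z) e)"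
proof -
  have "smooth_on \<tau> W"
    using assms unfolding smooth_atlas_def by blast
  then have *: "Ck_on (Suc 0) \<tau> W" unfolding smooth_on_def by blast
  then show "\<And>z. z \<in> W \<Longrightarrow> (\<tau> has_derivative frechet_derivative \<tau> (at z)) (at z)"
    using frechet_derivative_works by auto
  show "\<And>e. continuous_on W (\<lambda>z. frechet_derivative \<tau> (at z) e)"
    using * by auto
qed

text \<open>In another chart \<open>d\<close> the segment becomes the coordinate change applied to a
  straight line. By the chain rule its derivative is the differential applied to \<open>v\<close>,
  which is how \<open>tvec_of\<close> is defined; this derivative is bounded on compact time
  intervals, so the curve is Lipschitz there.\<close>

lemma chart_segment:
  fixes A :: "('m::{t2_space,second_countable_topology}, 'e::euclidean_space) chart set"
  assumes atlas: "smooth_atlas A" and c: "c \<in> A" and "T \<ge> 0"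
    and seg: "\<And>s. 0 \<le> s \<Longrightarrow> s \<le> T \<Longrightarrow> p + s *\<^sub>R v \<in> snd c ` fst c"
  defines "\<gamma> \<equiv> \<lambda>s. chart_inv c (p + s *\<^sub>R v)"
  shows ac_curve_chart_segment: "ac_curve A T \<gamma>"
    and velocity_chart_segment:
      "\<And>s. 0 \<le> s \<Longrightarrow> s \<le> T \<Longrightarrow> velocity A \<gamma> s = tvec_of A c (\<gamma> s) v"
proof -
  have inv: "\<gamma> s \<in> fst c" "snd c (\<gamma> s) = p + s *\<^sub>R v" if "0 \<le> s" "s \<le> T" for s
    using seg[OF that] unfolding \<gamma>_def by (auto intro: inv_into_into f_inv_into_f)
  let ?\<tau> = "\<lambda>d. snd d \<circ> chart_inv c"
  let ?D = "\<lambda>d s. frechet_derivative (?\<tau> d) (at (p + s *\<^sub>R v)) v"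
  have W: "p + s *\<^sub>R v \<in> snd c ` (fst c \<inter> fst d)" if "0 \<le> s" "s \<le> T" "\<gamma> s \<in> fst d" for s d
    using inv[OF that(1,2)] that(3) by (metis IntI imageI)
  \<comment> \<open>The derivative is two-sided even at the end times: the curve is defined for all
    real times, and the coordinate change is differentiable at these points without restriction to
    the segment.\<close>
  have deriv: "((snd d \<circ> \<gamma>) has_vector_derivative ?D d s) (at s)"
    if "d \<in> A" "0 \<le> s" "s \<le> T" "\<gamma> s \<in> fst d" for d s
  proof -
    have "((\<lambda>s. p + s *\<^sub>R v) has_vector_derivative v) (at s)"
      by (auto intro!: derivative_eq_intros)
    moreover have "(?\<tau> d has_derivative frechet_derivative (?\<tau> d) (at (p + s *\<^sub>R v)))
        (at (p + s *\<^sub>R v) within range (\<lambda>s. p + s *\<^sub>R v))"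
      using chart_transition(1)[OF atlas c that(1) W] that by (blast intro: has_derivative_at_withinI)
    ultimately have "(?\<tau> d \<circ> (\<lambda>s. p + s *\<^sub>R v) has_vector_derivative ?D d s) (at s)"
      by (rule vector_derivative_diff_chain_within)
    then show ?thesis by (simp add: \<gamma>_def o_def)
  qed
  show "velocity A \<gamma> s = tvec_of A c (\<gamma> s) v" if "0 \<le> s" "s \<le> T" for s
  proof -
    have "\<forall>d\<in>A. \<gamma> s \<in> fst d \<longrightarrow> (snd d \<circ> \<gamma>) differentiable (at s)"
      using deriv that by (blast intro: differentiableI_vector)
    then show ?thesis
      unfolding velocity_def tvec_of_def using vector_derivative_at[OF deriv] that inv by (auto intro!: ext)
  qed
  show "ac_curve A T \<gamma>"
    unfolding ac_curve_def
  proof (intro conjI ballI allI impI)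
    have "continuous_on (snd c ` fst c) (chart_inv c)"
      using atlas c unfolding smooth_atlas_def homeomorphism_def by blast
    then show "continuous_on {0..T} \<gamma>"
      unfolding \<gamma>_def
      by (rule continuous_on_compose2) (use seg in \<open>auto intro!: continuous_intros\<close>)
  next
    fix d a b
    assume d: "d \<in> A" and ab: "0 \<le> a \<and> a \<le> b \<and> b \<le> T \<and> \<gamma> ` {a..b} \<subseteq> fst d"
    have in_d: "0 \<le> s" "s \<le> T" "\<gamma> s \<in> fst d" if "s \<in> {a..b}" for s
      using ab that by auto
    have "continuous_on {a..b} (?D d)"
      by (rule continuous_on_compose2[OF chart_transition(2)[OF atlas c d]])
        (use W in_d in \<open>auto intro!: continuous_intros\<close>)
    then have "bounded (?D d ` {a..b})"
      by (simp add: compact_continuous_image compact_imp_bounded)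
    then obtain K where K: "K > 0" "\<And>s. s \<in> {a..b} \<Longrightarrow> norm (?D d s) \<le> K"
      by (auto simp: bounded_pos)
    have "K-lipschitz_on {a..b} (snd d \<circ> \<gamma>)"
    proof (rule bounded_derivative_imp_lipschitz)
      show "((snd d \<circ> \<gamma>) has_derivative (\<lambda>h. h *\<^sub>R ?D d s)) (at s within {a..b})"
        if "s \<in> {a..b}" for s
        using deriv[OF d in_d[OF that]] unfolding has_vector_derivative_def
        by (rule has_derivative_at_withinI)
      show "onorm (\<lambda>h. h *\<^sub>R ?D d s) \<le> K" if "s \<in> {a..b}" for s
        using mult_right_mono[OF K(2)[OF that]]
        by (intro onorm_le) (auto simp: mult.commute[of "\<bar>_\<bar>" "norm _"])
    qed (use K in auto)
    then show "abs_continuous_on_interval a b (snd d \<circ> \<gamma>)"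
      by (rule lipschitz_on_imp_abs_continuous_on_interval)
  qed
qed

lemma min_action_chart_segment_le:
  fixes A :: "('m::{t2_space,second_countable_topology}, 'e::euclidean_space) chart set"
  assumes atlas: "smooth_atlas A" and tonelli: "tonelli_lagrangian A g L" and c: "c \<in> A" and "T > 0"
    and "x \<in> fst c" "y \<in> fst c" and y: "snd c y = snd c x + T *\<^sub>R v"
    and seg: "\<And>s. 0 \<le> s \<Longrightarrow> s \<le> T \<Longrightarrow> snd c x + s *\<^sub>R v \<in> snd c ` fst c"
    and C: "\<And>s. 0 \<le> s \<Longrightarrow> s \<le> T \<Longrightarrow>
      L (chart_inv c (snd c x + s *\<^sub>R v)) (tvec_of A c (chart_inv c (snd c x + s *\<^sub>R v)) v) \<le> C"
  shows "min_action A L T x y \<le> ereal (T * C)"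
proof -
  define \<gamma> where "\<gamma> = (\<lambda>s. chart_inv c (snd c x + s *\<^sub>R v))"
  define f where "f = (\<lambda>s. L (\<gamma> s) (tvec_of A c (\<gamma> s) v))"
  define F where "F = (\<lambda>(p, e). L (chart_inv c p) (tvec_of A c (chart_inv c p) e))"
  have ac: "ac_curve A T \<gamma>"
    unfolding \<gamma>_def by (rule ac_curve_chart_segment[OF atlas c _ seg]) (use \<open>T > 0\<close> in simp_all)
  have vel: "velocity A \<gamma> s = tvec_of A c (\<gamma> s) v" if "0 \<le> s" "s \<le> T" for s
    unfolding \<gamma>_def
    by (rule velocity_chart_segment[OF atlas c _ seg]) (use that \<open>T > 0\<close> in simp_all)
  have "homeomorphism (fst c) (snd c ` fst c) (snd c) (chart_inv c)"
    using atlas c unfolding smooth_atlas_def by blast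
  note linv = homeomorphism_apply1[OF this]
  have ends: "\<gamma> 0 = x" "\<gamma> T = y"
    using linv \<open>x \<in> fst c\<close> \<open>y \<in> fst c\<close> unfolding \<gamma>_def y[symmetric] by simp_all
  have "continuous_on ((snd c ` fst c) \<times> UNIV) F"
    unfolding F_def using tonelli c by (rule tonelli_lagrangian_continuous_on_chart)
  then have "continuous_on {0..T} (\<lambda>s. F (snd c x + s *\<^sub>R v, v))"
    by (rule continuous_on_compose2) (use seg in \<open>auto intro!: continuous_intros\<close>)
  then have f: "continuous_on {0..T} f"
    by (simp add: f_def F_def \<gamma>_def)
  \<comment> \<open>The exceptional set is empty, as the two integrands agree on all of
    \<open>{0..T}\<close>, end times included.\<close>
  have int: "(\<lambda>s. L (\<gamma> s) (velocity A \<gamma> s)) absolutely_integrable_on {0..T}"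
    by (rule absolutely_integrable_spike[OF absolutely_integrable_continuous_real[OF f], of "{}"])
      (auto simp: f_def vel)
  have C': "L (\<gamma> s) (velocity A \<gamma> s) \<le> C" if "0 \<le> s" "s \<le> T" for s
    unfolding vel[OF that] unfolding \<gamma>_def by (rule C[OF that])
  have "integral {0..T} (\<lambda>s. L (\<gamma> s) (velocity A \<gamma> s)) \<le> integral {0..T} (\<lambda>s. C)"
    using int C' by (intro integral_le) (auto simp: absolutely_integrable_on_def)
  then have "action A L T \<gamma> \<le> ereal (T * C)"
    using int \<open>T > 0\<close> by (simp add: action_def)
  then show ?thesis
    unfolding min_action_def using ac ends \<open>T > 0\<close> by (intro INF_lower2[of \<gamma>]) auto
qed

text \<open>Segments of coordinate speed at most 1 in a small ball stay in a compact set of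
  positions and velocities, where the Lagrangian is at most some \<open>C\<close>; running for time
  \<open>T\<close> costs at most \<open>T * C\<close>. One time \<open>T\<close> serves all points
  of \<open>U\<close> and both directions.\<close>

lemma min_action_small_nearby:
  fixes A :: "('m::{t2_space,second_countable_topology}, 'e::euclidean_space) chart set"
  assumes atlas: "smooth_atlas A" and tonelli: "tonelli_lagrangian A g L" and "\<epsilon> > 0"
  obtains T U where "T > 0" "open U" "x \<in> U"
    "\<forall>w\<in>U. min_action A L T x w < ereal \<epsilon>"
    "\<forall>w\<in>U. min_action A L T w x < ereal \<epsilon>"
proof -
  obtain c where c: "c \<in> A" "x \<in> fst c"
    using atlas unfolding smooth_atlas_def by blast
  have op: "open (fst c)" "open (snd c ` fst c)" and cont: "continuous_on (fst c) (snd c)"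
    using atlas c unfolding smooth_atlas_def homeomorphism_def by blast+
  define F where "F = (\<lambda>(p, e). L (chart_inv c p) (tvec_of A c (chart_inv c p) e))"
  have "snd c x \<in> snd c ` fst c" using c(2) by (rule imageI)
  then have "\<exists>r>0. cball (snd c x) r \<subseteq> snd c ` fst c"
    using open_contains_cball op(2) by metis
  then obtain r where r: "r > 0" "cball (snd c x) r \<subseteq> snd c ` fst c" by (elim exE conjE)
  have "continuous_on ((snd c ` fst c) \<times> UNIV) F"
    unfolding F_def using tonelli c(1) by (rule tonelli_lagrangian_continuous_on_chart)
  then have "continuous_on (cball (snd c x) r \<times> cball 0 1) F"
    by (rule continuous_on_subset) (intro Sigma_mono r subset_UNIV)
  then have "bounded (F ` (cball (snd c x) r \<times> cball 0 1))"
    by (intro compact_imp_bounded compact_continuous_image compact_Times compact_cball)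
  then obtain C where C: "C > 0" "\<And>z. z \<in> F ` (cball (snd c x) r \<times> cball 0 1) \<Longrightarrow> norm z \<le> C"
    unfolding bounded_pos by blast
  have F_le: "L (chart_inv c p) (tvec_of A c (chart_inv c p) e) \<le> C"
    if "p \<in> cball (snd c x) r" "e \<in> cball 0 1" for p e
    using C(2)[OF imageI[of "(p, e)"]] that by (auto simp: F_def)
  \<comment> \<open>The bound \<open>r\<close> keeps the segments in the closed ball; the other one
    gives \<open>T * C \<le> \<epsilon> / 2\<close>. Since \<open>T\<close> is also the radius
    defining \<open>U\<close>, the speed is at most 1.\<close>
  define T where "T = min r (\<epsilon> / (2 * C))"
  define U where "U = fst c \<inter> snd c -` ball (snd c x) T"
  have T: "T > 0" "T \<le> r" "T * C < \<epsilon>"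
    using r C \<open>\<epsilon> > 0\<close> by (auto simp: T_def min_def field_simps)
  have U: "open U"
    unfolding U_def using cont op(1) open_ball by (rule continuous_open_preimage)
  have x: "x \<in> U" using c T by (simp add: U_def)
  \<comment> \<open>The Lagrangian need not be symmetric, so reversing a curve is no option; both
    directions are treated at once through \<open>y\<close> and \<open>z\<close>.\<close>
  have small: "min_action A L T y z < ereal \<epsilon>"
    if "w \<in> U" and yz: "y = x \<and> z = w \<or> y = w \<and> z = x" for w y z
  proof -
    define v where "v = (snd c z - snd c y) /\<^sub>R T"
    have w: "w \<in> fst c" "dist (snd c x) (snd c w) < T" using that by (auto simp: U_def)
    then have "dist (snd c y) (snd c z) < T" using yz by (auto simp: dist_commute)
    then have "norm v \<le> 1"
      using T by (simp add: v_def dist_norm norm_minus_commute divide_inverse_commute[symmetric])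
    then have v: "v \<in> cball 0 1" "snd c z = snd c y + T *\<^sub>R v"
      using T by (simp_all add: v_def)
    have seg: "snd c y + s *\<^sub>R v \<in> cball (snd c x) r" if "0 \<le> s" "s \<le> T" for s
    proof -
      have "snd c y + s *\<^sub>R v = (1 - s / T) *\<^sub>R snd c y + (s / T) *\<^sub>R snd c z"
        using T by (simp add: v_def algebra_simps divide_inverse)
      moreover have "snd c y \<in> cball (snd c x) r" "snd c z \<in> cball (snd c x) r"
        using yz w T r by auto
      ultimately show ?thesis
        using that T convexD_alt[OF convex_cball, of "snd c y" "snd c x" r "snd c z" "s / T"]
        by simp
    qed
    have "min_action A L T y z \<le> ereal (T * C)"
      by (rule min_action_chart_segment_le[OF atlas tonelli c(1) T(1), where v = v])
        (use yz w c v seg r F_le in blast)+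
    then show ?thesis using T(3) by (simp add: le_less_trans)
  qed
  have "\<forall>w\<in>U. min_action A L T x w < ereal \<epsilon>" "\<forall>w\<in>U. min_action A L T w x < ereal \<epsilon>"
    by (intro ballI, erule small, simp)+
  with T(1) U x show ?thesis by (rule that)
qed

section \<open>The Peierls barrier\<close>

text \<open>This turns an upper bound on the barrier into strict real bounds at arbitrarily late
  times, the form that \<open>min_action_triangle\<close> accepts.\<close>

lemma Liminf_at_top_le_ereal_iff:
  fixes f :: "real \<Rightarrow> ereal"
  shows "Liminf at_top f \<le> ereal a \<longleftrightarrow> (\<forall>\<epsilon>>0. \<forall>T. \<exists>t\<ge>T. f t < ereal (a + \<epsilon>))"
proof
  assume le: "Liminf at_top f \<le> ereal a"
  show "\<forall>\<epsilon>>0. \<forall>T. \<exists>t\<ge>T. f t < ereal (a + \<epsilon>)"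
  proof (rule ccontr)
    assume "\<not> ?thesis"
    then obtain \<epsilon> T where "\<epsilon> > 0" "\<And>t. t \<ge> T \<Longrightarrow> ereal (a + \<epsilon>) \<le> f t"
      by (metis linorder_not_less)
    then have "ereal (a + \<epsilon>) \<le> Liminf at_top f"
      by (intro Liminf_bounded eventually_at_top_linorderI[of T])
    then show False
      using le \<open>\<epsilon> > 0\<close> order_trans by fastforce
  qed
next
  assume freq: "\<forall>\<epsilon>>0. \<forall>T. \<exists>t\<ge>T. f t < ereal (a + \<epsilon>)"
  show "Liminf at_top f \<le> ereal a"
  proof (rule ccontr)
    assume "\<not> ?thesis"
    then obtain b where b: "ereal a < ereal b" "ereal b < Liminf at_top f"
      using ereal_dense2 by (metis linorder_not_le)
    from less_LiminfD[OF b(2)] obtain T where "\<And>t. t \<ge> T \<Longrightarrow> ereal b < f t"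
      unfolding eventually_at_top_linorder by blast
    moreover obtain t where "t \<ge> T" "f t < ereal (a + (b - a))"
      using freq b by (metis diff_gt_0_iff_gt ereal_less_eq(3) linorder_not_le)
    ultimately show False by fastforce
  qed
qed

lemma peierls_barrier_eq_Liminf:
  assumes "mane_critical_value A L = 0"
  shows "peierls_barrier A L x y = Liminf at_top (\<lambda>t. min_action A L t x y)"
  unfolding peierls_barrier_def barrier_at_def assms by simp

lemma peierls_barrier_le_iff:
  assumes "mane_critical_value A L = 0"
  shows "peierls_barrier A L x y \<le> ereal a
    \<longleftrightarrow> (\<forall>\<epsilon>>0. \<forall>T. \<exists>t\<ge>T. min_action A L t x y < ereal (a + \<epsilon>))"
  unfolding peierls_barrier_eq_Liminf[OF assms] by (rule Liminf_at_top_le_ereal_iff)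

lemma peierls_barrier_triangle:
  assumes crit: "mane_critical_value A L = 0"
    and "peierls_barrier A L x y \<le> ereal a" "peierls_barrier A L y z \<le> ereal b"
  shows "peierls_barrier A L x z \<le> ereal (a + b)"
  unfolding peierls_barrier_le_iff[OF crit]
proof (intro allI impI)
  fix \<epsilon> T :: real assume "\<epsilon> > 0"
  then have e: "\<epsilon> / 2 > 0" by simp
  \<comment> \<open>The bound \<open>max T 0\<close> makes both times nonnegative, as concatenation
    demands, and keeps their sum above \<open>T\<close>.\<close>
  obtain s where s: "s \<ge> max T 0" "min_action A L s x y < ereal (a + \<epsilon> / 2)"
    using assms(2) e unfolding peierls_barrier_le_iff[OF crit] by meson
  obtain t where t: "t \<ge> max T 0" "min_action A L t y z < ereal (b + \<epsilon> / 2)"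
    using assms(3) e unfolding peierls_barrier_le_iff[OF crit] by meson
  have "min_action A L (s + t) x z < ereal (a + b + \<epsilon>)"
    using min_action_triangle[OF s(2) t(2)] s(1) t(1) by (simp add: algebra_simps)
  then show "\<exists>t\<ge>T. min_action A L t x z < ereal (a + b + \<epsilon>)"
    using s(1) t(1) by (intro exI[of _ "s + t"]) auto
qed

text \<open>A joint lower semicontinuity in time and endpoints: cheap short arcs from
  \<open>x\<close> to \<open>X n\<close> and from \<open>Y n\<close> to \<open>y\<close> are
  attached to the given almost optimal curves. All later limits are taken through this
  lemma.\<close>

lemma peierls_barrier_le_of_tendsto:
  fixes A :: "('m::{t2_space,second_countable_topology}, 'e::euclidean_space) chart set"
  assumes atlas: "smooth_atlas A" and tonelli: "tonelli_lagrangian A g L"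
    and crit: "mane_critical_value A L = 0"
    and X: "X \<longlonglongrightarrow> x" and Y: "Y \<longlonglongrightarrow> y" and a: "a \<longlonglongrightarrow> a'"
    and t: "filterlim t at_top sequentially"
    and less: "\<And>n. min_action A L (t n) (X n) (Y n) < ereal (a n)"
  shows "peierls_barrier A L x y \<le> ereal a'"
  unfolding peierls_barrier_le_iff[OF crit]
proof (intro allI impI)
  fix \<epsilon> T :: real assume "\<epsilon> > 0"
  then have e: "\<epsilon> / 4 > 0" by simp
  obtain S U where U: "S > 0" "open U" "x \<in> U"
    "\<forall>w\<in>U. min_action A L S x w < ereal (\<epsilon> / 4)"
    "\<forall>w\<in>U. min_action A L S w x < ereal (\<epsilon> / 4)"
    using min_action_small_nearby[OF atlas tonelli e, where x = x] .
  obtain R V where V: "R > 0" "open V" "y \<in> V"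
    "\<forall>w\<in>V. min_action A L R y w < ereal (\<epsilon> / 4)"
    "\<forall>w\<in>V. min_action A L R w y < ereal (\<epsilon> / 4)"
    using min_action_small_nearby[OF atlas tonelli e, where x = y] .
  have "\<forall>\<^sub>F n in sequentially. X n \<in> U \<and> Y n \<in> V \<and> a n < a' + \<epsilon> / 2 \<and> t n \<ge> max T 0"
    using topological_tendstoD[OF X U(2,3)] topological_tendstoD[OF Y V(2,3)]
      order_tendstoD(2)[OF a, of "a' + \<epsilon> / 2"] \<open>\<epsilon> > 0\<close>
      filterlim_at_top[THEN iffD1, OF t, rule_format, of "max T 0"]
    by (simp add: eventually_conj_iff)
  then obtain n where n: "X n \<in> U" "Y n \<in> V" "a n < a' + \<epsilon> / 2" "t n \<ge> max T 0"
    using eventually_happens'[OF sequentially_bot] by blast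
  \<comment> \<open>Error budget: \<open>\<epsilon> / 4\<close> for each connecting arc and
    \<open>\<epsilon> / 2\<close> for the convergence of \<open>a\<close>.\<close>
  have "min_action A L (S + t n) x (Y n) < ereal (\<epsilon> / 4 + a n)"
    using min_action_triangle[OF bspec[OF U(4) n(1)] less] U(1) n(4) by simp
  from min_action_triangle[OF this bspec[OF V(5) n(2)]]
  have "min_action A L (S + t n + R) x y < ereal (\<epsilon> / 4 + a n + \<epsilon> / 4)"
    using U(1) V(1) n(4) by simp
  also have "\<dots> \<le> ereal (a' + \<epsilon>)" using n(3) by simp
  finally show "\<exists>t\<ge>T. min_action A L t x y < ereal (a' + \<epsilon>)"
    using U(1) V(1) n(4) by (intro exI[of _ "S + t n + R"]) auto
qed

section \<open>Domination and almost calibrated steps\<close>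

lemma weak_KAM_dominated:
  assumes "weak_KAM_solution A L u" "t > 0"
  shows "ereal (u y - u x) \<le> min_action A L t x y"
proof -
  have "ereal (u y) = (INF z. ereal (u z) + min_action A L t z y)"
    using assms unfolding weak_KAM_solution_def by blast
  also have "\<dots> \<le> ereal (u x) + min_action A L t x y"
    by (rule INF_lower) simp
  finally show ?thesis
    by (cases "min_action A L t x y") auto
qed

text \<open>Domination holds at every positive time, so it survives the lower limit; in particular
  the barrier is never \<open>-\<infinity>\<close>.\<close>

lemma weak_KAM_le_peierls_barrier:
  assumes "mane_critical_value A L = 0" "weak_KAM_solution A L u"
  shows "ereal (u y - u x) \<le> peierls_barrier A L x y"
  unfolding peierls_barrier_eq_Liminf[OF assms(1)]
  using weak_KAM_dominated[OF assms(2)]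
  by (intro Liminf_bounded eventually_mono[OF eventually_gt_at_top[of 0]])

lemma weak_KAM_almost_calibrated:
  assumes "weak_KAM_solution A L u" "t > 0" "\<epsilon> > 0"
  obtains z where "min_action A L t z y < ereal (u y - u z + \<epsilon>)"
proof -
  have "(INF z. ereal (u z) + min_action A L t z y) = ereal (u y)"
    using assms unfolding weak_KAM_solution_def by simp
  also have "\<dots> < ereal (u y + \<epsilon>)" using assms by simp
  finally obtain z where "ereal (u z) + min_action A L t z y < ereal (u y + \<epsilon>)"
    unfolding INF_less_iff by blast
  then have "min_action A L t z y < ereal (u y - u z + \<epsilon>)"
    by (cases "min_action A L t z y") auto
  then show ?thesis by (rule that)
qed

lemma weak_KAM_tendsto:
  fixes u :: "'m::t2_space \<Rightarrow> real" and A :: "('m, 'e::euclidean_space) chart set"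
  assumes "weak_KAM_solution A L u" "X \<longlonglongrightarrow> x"
  shows "(\<lambda>n. u (X n)) \<longlonglongrightarrow> u x"
  using assms(1) unfolding weak_KAM_solution_def
  by (intro isCont_tendsto_compose[OF _ assms(2)]) (simp add: continuous_on_eq_continuous_at)

text \<open>Second countability entails first countability, under which compactness gives sequential
  compactness.\<close>

lemma closed_manifold_convergent_subseq:
  fixes X :: "nat \<Rightarrow> 'm::{t2_space,second_countable_topology}"
  assumes "closed_manifold (A :: ('m, 'e::euclidean_space) chart set)"
  obtains r x where "strict_mono (r :: nat \<Rightarrow> nat)" "(\<lambda>n. X (r n)) \<longlonglongrightarrow> x"
proof -
  have "seq_compact (UNIV :: 'm set)"
    using assms unfolding closed_manifold_def by (blast intro: compact_imp_seq_compact)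
  then obtain x r where "strict_mono (r :: nat \<Rightarrow> nat)" "(X \<circ> r) \<longlonglongrightarrow> x"
    by (rule seq_compactE[of _ X]) simp_all
  then show ?thesis using that by (simp add: o_def)
qed

section \<open>Calibrated points of the Aubry set\<close>

text \<open>Only the second bound carries \<open>\<epsilon>\<close>: between two late visits near
  the limit point the accumulated error tends to zero, whereas the path down to \<open>y\<close>
  collects all of it.\<close>

lemma weak_KAM_calibrated_up_to:
  fixes A :: "('m::{t2_space,second_countable_topology}, 'e::euclidean_space) chart set"
  assumes manifold: "closed_manifold A" and tonelli: "tonelli_lagrangian A g L"
    and crit: "mane_critical_value A L = 0" and u: "weak_KAM_solution A L u" and "\<epsilon> > 0"
  obtains x where "peierls_barrier A L x x \<le> 0" "peierls_barrier A L x y \<le> ereal (u y - u x + \<epsilon>)"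
proof -
  have atlas: "smooth_atlas A" using manifold unfolding closed_manifold_def by blast
  have "\<exists>w. min_action A L 1 w z < ereal (u z - u w + \<epsilon> / 2 ^ Suc k)" for k :: nat and z
    using weak_KAM_almost_calibrated[OF u, of 1 "\<epsilon> / 2 ^ Suc k" z] \<open>\<epsilon> > 0\<close> by auto
  then have "\<forall>k z. \<exists>w. min_action A L 1 w z < ereal (u z - u w + \<epsilon> / 2 ^ Suc k)"
    by (intro allI)
  from this[unfolded choice_iff] obtain prev where prev: "\<And>k z. min_action A L 1 (prev k z) z
      < ereal (u z - u (prev k z) + \<epsilon> / 2 ^ Suc k)"
    by blast
  define q where "q = rec_nat y prev"
  \<comment> \<open>Adding the remaining error \<open>\<epsilon> / 2 ^ k\<close> to \<open>u\<close>
    makes the step costs telescope, since \<open>\<epsilon> / 2 ^ k - \<epsilon> / 2 ^ Suc k =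
    \<epsilon> / 2 ^ Suc k\<close>. In particular \<open>b 0 = u y + \<epsilon>\<close>.\<close>
  define b where "b = (\<lambda>k. u (q k) + \<epsilon> / 2 ^ k)"
  have q0: "q 0 = y" by (simp add: q_def)
  have step: "min_action A L 1 (q (Suc k)) (q k) < ereal (b k - b (Suc k))" for k
  proof -
    have "b k - b (Suc k) = u (q k) - u (q (Suc k)) + \<epsilon> / 2 ^ Suc k"
      by (simp add: b_def field_simps)
    then show ?thesis using prev[of k "q k"] by (simp add: q_def)
  qed
  \<comment> \<open>The induction starts with one step, because the strict inequality fails for zero
    steps.\<close>
  have chain: "min_action A L (real (Suc j)) (q (i + Suc j)) (q i) < ereal (b i - b (i + Suc j))"
    for i j
  proof (induction j)
    case 0 then show ?case using step[of i] by simp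
  next
    case (Suc j)
    show ?case
      using min_action_triangle[OF step Suc] by (simp add: algebra_simps)
  qed
  have chain': "min_action A L (real (k - i)) (q k) (q i) < ereal (b i - b k)" if "i < k" for i k
    using chain[of "k - Suc i" i] that by (simp add: Suc_diff_Suc)
  obtain r x where r: "strict_mono r" and x: "(\<lambda>n. q (r n)) \<longlonglongrightarrow> x"
    using closed_manifold_convergent_subseq[OF manifold] .
  have "(\<lambda>k. \<epsilon> / 2 ^ k) \<longlonglongrightarrow> 0"
    by (rule LIMSEQ_divide_realpow_zero) simp
  from tendsto_add[OF weak_KAM_tendsto[OF u x] LIMSEQ_subseq_LIMSEQ[OF this r]]
  have b: "(\<lambda>n. b (r n)) \<longlonglongrightarrow> u x"
    by (simp add: b_def o_def)
  \<comment> \<open>By \<open>gap\<close>, passing from \<open>n\<close> to \<open>2 * n + 1\<close>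
    leaves more than \<open>n\<close> units of time between the two visits, so the loop times tend
    to infinity.\<close>
  define s where "s = (\<lambda>n::nat. 2 * n + 1)"
  have s: "strict_mono s" "strict_mono Suc" unfolding s_def strict_mono_def by simp_all
  have gap: "r n + k \<le> r (n + k)" for n k
  proof (induction k)
    case (Suc k)
    then show ?case using strict_monoD[OF r, of "n + k" "n + Suc k"] by simp
  qed simp
  have "peierls_barrier A L x x \<le> ereal (u x - u x)"
  proof (rule peierls_barrier_le_of_tendsto[OF atlas tonelli crit])
    show "(\<lambda>n. q (r (s n))) \<longlonglongrightarrow> x" "(\<lambda>n. q (r n)) \<longlonglongrightarrow> x"
      using x LIMSEQ_subseq_LIMSEQ[OF x s(1)] by (simp_all add: o_def)
    show "(\<lambda>n. b (r n) - b (r (s n))) \<longlonglongrightarrow> u x - u x"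
      using b LIMSEQ_subseq_LIMSEQ[OF b s(1)] by (intro tendsto_diff) (simp_all add: o_def)
    have *: "n < r (s n) - r n" for n using gap[of n "Suc n"] by (simp add: s_def mult_2)
    then show "filterlim (\<lambda>n. real (r (s n) - r n)) at_top sequentially"
      by (intro filterlim_at_top_mono[OF filterlim_real_sequentially] always_eventually allI
          of_nat_mono less_imp_le)
    show "min_action A L (real (r (s n) - r n)) (q (r (s n))) (q (r n))
        < ereal (b (r n) - b (r (s n)))" for n
      using *[of n] by (intro chain') simp
  qed
  moreover have "peierls_barrier A L x y \<le> ereal (b 0 - u x)"
  proof (rule peierls_barrier_le_of_tendsto[OF atlas tonelli crit])
    show "(\<lambda>n. q (r (Suc n))) \<longlonglongrightarrow> x"
      using LIMSEQ_subseq_LIMSEQ[OF x s(2)] by (simp add: o_def)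
    show "(\<lambda>n. b 0 - b (r (Suc n))) \<longlonglongrightarrow> b 0 - u x"
      using LIMSEQ_subseq_LIMSEQ[OF b s(2)] by (intro tendsto_diff) (simp_all add: o_def)
    \<comment> \<open>The shift by \<open>Suc\<close> makes the index positive even for
      \<open>n = 0\<close>, as \<open>chain'\<close> requires when it ends at
      \<open>q 0\<close>.\<close>
    have *: "n < r (Suc n)" for n using seq_suble[OF r, of "Suc n"] by simp
    then show "filterlim (\<lambda>n. real (r (Suc n))) at_top sequentially"
      by (intro filterlim_at_top_mono[OF filterlim_real_sequentially] always_eventually allI
          of_nat_mono less_imp_le)
    show "min_action A L (real (r (Suc n))) (q (r (Suc n))) y < ereal (b 0 - b (r (Suc n)))" for n
      using chain'[of 0 "r (Suc n)"] *[of n] by (simp add: q0)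
  qed simp
  ultimately show ?thesis
    by (intro that[of x]) (simp_all add: b_def q0 algebra_simps flip: zero_ereal_def)
qed

text \<open>The errors \<open>inverse (real (Suc n))\<close> tend to zero along a convergent
  subsequence of the points \<open>p n\<close>. Upper bounds pass to the limit point, and domination
  supplies the reverse inequalities.\<close>

lemma weak_KAM_calibrated:
  fixes A :: "('m::{t2_space,second_countable_topology}, 'e::euclidean_space) chart set"
  assumes manifold: "closed_manifold A" and tonelli: "tonelli_lagrangian A g L"
    and crit: "mane_critical_value A L = 0" and u: "weak_KAM_solution A L u"
  obtains x where "x \<in> aubry_set A L" "peierls_barrier A L x y = ereal (u y - u x)"
proof -
  have atlas: "smooth_atlas A" using manifold unfolding closed_manifold_def by blast
  have "\<exists>x. peierls_barrier A L x x \<le> 0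
      \<and> peierls_barrier A L x y \<le> ereal (u y - u x + inverse (real (Suc n)))" for n
    by (rule weak_KAM_calibrated_up_to[OF assms, of "inverse (real (Suc n))" y]) auto
  then obtain p where p: "\<And>n. peierls_barrier A L (p n) (p n) \<le> ereal 0"
    "\<And>n. peierls_barrier A L (p n) y \<le> ereal (u y - u (p n) + inverse (real (Suc n)))"
    by (metis zero_ereal_def)
  have "\<exists>t\<ge>real n. min_action A L t (p n) (p n) < ereal (0 + inverse (real (Suc n)))" for n
    using p(1)[unfolded peierls_barrier_le_iff[OF crit]] by simp
  then obtain s where s: "\<And>n. s n \<ge> real n"
    "\<And>n. min_action A L (s n) (p n) (p n) < ereal (inverse (real (Suc n)))"
    unfolding add_0_left by metis
  \<comment> \<open>One error term comes from the approximate calibration of \<open>p n\<close>, the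
    other from replacing the barrier by the action at a finite late time.\<close>
  have "\<exists>t\<ge>real n. min_action A L t (p n) y
      < ereal (u y - u (p n) + inverse (real (Suc n)) + inverse (real (Suc n)))" for n
    by (rule p(2)[unfolded peierls_barrier_le_iff[OF crit], rule_format]) simp
  then obtain t where t: "\<And>n. t n \<ge> real n" "\<And>n. min_action A L (t n) (p n) y
      < ereal (u y - u (p n) + inverse (real (Suc n)) + inverse (real (Suc n)))"
    by metis
  obtain r x where r: "strict_mono r" and x: "(\<lambda>n. p (r n)) \<longlonglongrightarrow> x"
    using closed_manifold_convergent_subseq[OF manifold] .
  note ux = weak_KAM_tendsto[OF u x]
  have inv: "(\<lambda>n. inverse (real (Suc (r n)))) \<longlonglongrightarrow> 0"
    using LIMSEQ_subseq_LIMSEQ[OF LIMSEQ_inverse_real_of_nat r] by (simp add: o_def)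
  have at_top: "filterlim (\<lambda>n. \<tau> (r n)) at_top sequentially"
    if "\<And>n. \<tau> n \<ge> real n" for \<tau> :: "nat \<Rightarrow> real"
  proof (rule filterlim_compose[OF _ filterlim_subseq[OF r]])
    show "filterlim \<tau> at_top sequentially"
      using that by (intro filterlim_at_top_mono[OF filterlim_real_sequentially] always_eventually allI)
  qed
  have "peierls_barrier A L x x \<le> ereal 0"
    by (rule peierls_barrier_le_of_tendsto[OF atlas tonelli crit x x inv at_top[OF s(1)] s(2)])
  moreover have "ereal 0 \<le> peierls_barrier A L x x"
    using weak_KAM_le_peierls_barrier[OF crit u, of x x] by simp
  ultimately have "x \<in> aubry_set A L"
    by (simp add: aubry_set_def zero_ereal_def)
  moreover have "(\<lambda>n. u y - u (p (r n)) + inverse (real (Suc (r n))) + inverse (real (Suc (r n))))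
      \<longlonglongrightarrow> u y - u x + 0 + 0"
    by (intro tendsto_add tendsto_diff tendsto_const ux inv)
  from peierls_barrier_le_of_tendsto[OF atlas tonelli crit x tendsto_const this at_top[OF t(1)] t(2)]
  have "peierls_barrier A L x y \<le> ereal (u y - u x)" by simp
  then have "peierls_barrier A L x y = ereal (u y - u x)"
    using weak_KAM_le_peierls_barrier[OF crit u, where y = y and x = x] by (simp add: antisym)
  ultimately show ?thesis by (rule that)
qed

section \<open>From calibration to the static class\<close>

text \<open>By domination \<open>u z - h x z\<close> is at most \<open>u x\<close> for every
  \<open>z\<close>, and calibration says that this bound is reached at \<open>z = y\<close>.\<close>

lemma c_superdifferential_of_calibrated:
  assumes crit: "mane_critical_value A L = 0" and u: "weak_KAM_solution A L u"
    and "peierls_barrier A L x y \<le> ereal (u y - u x)"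
  shows "x \<in> c_superdifferential (peierls_barrier A L) u y"
  unfolding c_superdifferential_def
proof (intro CollectI allI)
  fix z
  have "ereal (u z) - peierls_barrier A L x z \<le> ereal (u z) - ereal (u z - u x)"
    by (intro ereal_minus_mono weak_KAM_le_peierls_barrier[OF crit u]) simp
  also have "\<dots> = ereal (u y) - ereal (u y - u x)" by simp
  also have "\<dots> \<le> ereal (u y) - peierls_barrier A L x y"
    by (intro ereal_minus_mono assms(3)) simp
  finally show "ereal (u z) - peierls_barrier A L x z \<le> ereal (u y) - peierls_barrier A L x y" .
qed

theorem proposition3p15:
  fixes A :: "('m::{t2_space,second_countable_topology}, 'e::euclidean_space) chart set"
    and g :: "'m \<Rightarrow> ('m, 'e) tvec \<Rightarrow> ('m, 'e) tvec \<Rightarrow> real"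
    and L :: "'m \<Rightarrow> ('m, 'e) tvec \<Rightarrow> real"
    and u :: "'m \<Rightarrow> real"
    and y :: 'm
  assumes "closed_manifold A"
    and "connected (UNIV :: 'm set)"
    and "riemannian_metric A g"
    and "tonelli_lagrangian A g L"
    and "mane_critical_value A L = 0"
    and "weak_KAM_solution A L u"
  shows "\<exists>C\<in>static_classes A L. C \<subseteq> c_superdifferential (peierls_barrier A L) u y"
proof -
  let ?h = "peierls_barrier A L"
  note dom = weak_KAM_le_peierls_barrier[OF assms(5,6)]
  obtain x where x: "x \<in> aubry_set A L" "?h x y = ereal (u y - u x)"
    using weak_KAM_calibrated[OF assms(1,4,5,6)] .
  let ?R = "{(x, y). x \<in> aubry_set A L \<and> y \<in> aubry_set A L \<and> ?h x y + ?h y x = 0}"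
  have "?R `` {x} \<in> static_classes A L"
    unfolding static_classes_def by (rule quotientI) fact
  moreover have "?R `` {x} \<subseteq> c_superdifferential ?h u y"
  proof
    fix x' assume "x' \<in> ?R `` {x}"
    then have zero: "?h x x' + ?h x' x = 0" by simp
    \<comment> \<open>Domination bounds \<open>?h x x'\<close> below by \<open>u x' - u x\<close>;
      as the two barriers add up to zero, the other one is bounded above. The case split disposes of
      infinite values.\<close>
    have "?h x' x \<le> ereal (u x - u x')"
      using zero dom[of x' x] by (cases "?h x x'"; cases "?h x' x") auto
    \<comment> \<open>Calibration propagates: the bounds for \<open>x'\<close> to \<open>x\<close>
      and for \<open>x\<close> to \<open>y\<close> telescope to \<open>u y - u x'\<close>.\<close>
    from peierls_barrier_triangle[OF assms(5) this eq_refl[OF x(2)]]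
    have "?h x' y \<le> ereal (u y - u x')" by simp
    then show "x' \<in> c_superdifferential ?h u y"
      by (rule c_superdifferential_of_calibrated[OF assms(5,6)])
  qed
  ultimately show ?thesis by blast
qed

end
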